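(* Let $G$ be a finite non-nilpotent group. For every finite nilpotent group $H$, it holds that $\kappa(G\times H)=\kappa(G)$. In particular, $\Gamma_{\mathfrak N}(G)$ is connected if and only if $\Gamma_{\mathfrak N}(G\times H)$ is connected for every finite nilpotent group $H$.
   Context: For a finite group $G$, $\mathrm{nil}(G)=\{g\in G:\langle g,h\rangle \text{ is nilpotent for all } h\in G\}$. For a finite non-nilpotent group $G$, the nilpotent graph $\Gamma_{\mathfrak N}(G)$ is the simple undirected graph with vertex set $G-\mathrm{nil}(G)$ (set difference) in which two distinct vertices $g,h$ are adjacent if and only if $\langle g,h\rangle$ is nilpotent. $\kappa(G)$ denotes the number of connected components of $\Gamma_{\mathfrak N}(G)$. *)

theory Defs
  imports "HOL-Algebra.Algebra" "Graph_Theory.Graph_Theory"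
begin

primrec lower_central_series :: "('a, 'b) monoid_scheme \<Rightarrow> nat \<Rightarrow> 'a set" where
  "lower_central_series G 0 = carrier G"
| "lower_central_series G (Suc n) =
     generate G (\<Union>x \<in> lower_central_series G n. \<Union>y \<in> carrier G.
       {x \<otimes>\<^bsub>G\<^esub> y \<otimes>\<^bsub>G\<^esub> inv\<^bsub>G\<^esub> x \<otimes>\<^bsub>G\<^esub> inv\<^bsub>G\<^esub> y})"

definition nilpotent_group :: "('a, 'b) monoid_scheme \<Rightarrow> bool" where
  "nilpotent_group G \<longleftrightarrow> group G \<and> (\<exists>n. lower_central_series G n = {\<one>\<^bsub>G\<^esub>})"

definition nil_set :: "('a, 'b) monoid_scheme \<Rightarrow> 'a set" where
  "nil_set G = {g \<in> carrier G. \<forall>h \<in> carrier G. nilpotent_group (subgroup_generated G {g, h})}"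

text \<open>
  As usual in \<^theory>\<open>Graph_Theory.Digraph\<close>, a simple graph is a loop-free symmetric digraph
  without parallel arcs: an undirected edge is the pair of its two orientations.
\<close>

definition nilpotent_graph :: "('a, 'b) monoid_scheme \<Rightarrow> ('a, 'a \<times> 'a) pre_digraph" where
  "nilpotent_graph G =
     \<lparr> verts = carrier G - nil_set G,
       arcs = {(g, h). g \<in> carrier G - nil_set G \<and> h \<in> carrier G - nil_set G \<and> g \<noteq> h \<and>
                 nilpotent_group (subgroup_generated G {g, h})},
       tail = fst,
       head = snd \<rparr>"

lemma graph_nilpotent_graph:
  assumes "finite (carrier G)"
  shows "graph (nilpotent_graph G)"
proof
  let ?V = "carrier G - nil_set G"
  have "arcs (nilpotent_graph G) \<subseteq> ?V \<times> ?V"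
    by (auto simp: nilpotent_graph_def)
  then show "finite (arcs (nilpotent_graph G))"
    by (rule finite_subset) (use assms in simp)
qed (use assms in \<open>auto simp: nilpotent_graph_def arc_to_ends_def symmetric_conv insert_commute\<close>)

text \<open>
  Connected components are the maximal connected subgraphs. Connectedness is that of
  \<^theory>\<open>Graph_Theory.Digraph_Component\<close>, which excludes the empty graph; the name is
  qualified because it competes with topological connectedness.
\<close>

definition connected_components :: "('v, 'e) pre_digraph \<Rightarrow> ('v, 'e) pre_digraph set" where
  "connected_components \<Gamma> = {C. pre_digraph.max_subgraph \<Gamma> Digraph_Component.connected C}"

definition kappa :: "('a, 'b) monoid_scheme \<Rightarrow> nat" where
  "kappa G = card (connected_components (nilpotent_graph G))"

end

theory Submission
  imports Defs
begin

text \<open>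
  Two elements \<open>(a, x)\<close> and \<open>(b, y)\<close> of \<open>G \<times> H\<close> generate a nilpotent subgroup exactly when \<open>a\<close>
  and \<open>b\<close> do in \<open>G\<close> (\<open>nilpotent_subgroup_generated_DirProd_iff\<close>): the subgroup
  \<open>\<langle>(a, x), (b, y)\<rangle>\<close> maps onto \<open>\<langle>a, b\<rangle>\<close> and embeds into \<open>\<langle>a, b\<rangle> \<times> H\<close>, and nilpotency passes to
  images, and from two groups to anything embedded in their product.

  Hence \<open>nil(G \<times> H) = nil(G) \<times> H\<close>, and the nilpotent graph of \<open>G \<times> H\<close> is that of \<open>G\<close> with every
  vertex \<open>a\<close> blown up to the clique \<open>{a} \<times> H\<close>; it is a clique because \<open>\<langle>a\<rangle>\<close> is cyclic, hence
  nilpotent. The first projection therefore preserves and reflects reachability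
  (\<open>nilpotent_graph_DirProd_projection\<close>), which makes it a bijection on connected components and
  makes one graph connected exactly when the other is. For the second claim, the direction from
  the products back to \<open>G\<close> needs just one finite nilpotent group of the type of \<open>H\<close>, and the
  trivial group serves.
\<close>

section \<open>The lower central series under homomorphisms\<close>

lemma (in group) lower_central_series_in_carrier:
  "lower_central_series G n \<subseteq> carrier G"
proof (induction n)
  case (Suc n)
  then show ?case
    unfolding lower_central_series.simps by (intro generate_incl) auto
qed simp

lemma (in group) one_in_lower_central_series:
  "\<one> \<in> lower_central_series G n"
  by (cases n) (auto intro: generate.one)

lemma (in group) lower_central_series_trivial_mono:
  assumes "lower_central_series G m = {\<one>}" "m \<le> n"
  shows "lower_central_series G n = {\<one>}"
  using assms(2)
proof (induction n rule: dec_induct)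
  case (step n)
  have "(\<Union>x \<in> {\<one>}. \<Union>y \<in> carrier G. {x \<otimes> y \<otimes> inv x \<otimes> inv y}) = {\<one>}"
    by auto
  then show ?case
    by (simp only: lower_central_series.simps step.IH generate_one)
qed (fact assms(1))

text \<open>
  The common step of the next two inductions: only the images of the previous term and of the
  carrier enter, which are contained in, or equal to, the corresponding sets of the target.
\<close>

lemma (in group_hom) lower_central_series_Suc_image:
  "h ` lower_central_series G (Suc n) =
     generate H (\<Union>x \<in> h ` lower_central_series G n. \<Union>y \<in> h ` carrier G.
       {x \<otimes>\<^bsub>H\<^esub> y \<otimes>\<^bsub>H\<^esub> inv\<^bsub>H\<^esub> x \<otimes>\<^bsub>H\<^esub> inv\<^bsub>H\<^esub> y})"
proof -
  let ?X = "\<Union>x \<in> lower_central_series G n. \<Union>y \<in> carrier G. {x \<otimes> y \<otimes> inv x \<otimes> inv y}"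
  have carr: "x \<in> carrier G" if "x \<in> lower_central_series G n" for x
    using that G.lower_central_series_in_carrier by blast
  have "h ` ?X = (\<Union>x \<in> h ` lower_central_series G n. \<Union>y \<in> h ` carrier G.
       {x \<otimes>\<^bsub>H\<^esub> y \<otimes>\<^bsub>H\<^esub> inv\<^bsub>H\<^esub> x \<otimes>\<^bsub>H\<^esub> inv\<^bsub>H\<^esub> y})"
    by (simp add: image_UN carr)
  moreover have "generate H (h ` ?X) = h ` generate G ?X"
    by (rule generate_img) (use carr in auto)
  ultimately show ?thesis
    by simp
qed

lemma (in group_hom) lower_central_series_image_subset:
  "h ` lower_central_series G n \<subseteq> lower_central_series H n"
proof (induction n)
  case (Suc n)
  then show ?case
    unfolding lower_central_series_Suc_image lower_central_series.simps(2)[of H]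
    by (intro H.mono_generate UN_mono) auto
qed auto

lemma (in group_hom) lower_central_series_image_eq:
  assumes "h ` carrier G = carrier H"
  shows "h ` lower_central_series G n = lower_central_series H n"
proof (induction n)
  case (Suc n)
  then show ?case
    unfolding lower_central_series_Suc_image lower_central_series.simps(2)[of H] assms by simp
qed (simp add: assms)

lemma nilpotent_group_epi_image:
  assumes "nilpotent_group G" "group H" "f \<in> epi G H"
  shows "nilpotent_group H"
proof -
  interpret group_hom G H f
    using assms
    by (simp add: group_hom_def group_hom_axioms_def nilpotent_group_def epi_def)
  obtain n where "lower_central_series G n = {\<one>\<^bsub>G\<^esub>}"
    using assms(1) by (auto simp: nilpotent_group_def)
  with lower_central_series_image_eq[of n] assms(3)
  have "lower_central_series H n = {\<one>\<^bsub>H\<^esub>}"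
    by (simp add: epi_def)
  then show ?thesis
    using assms(2) by (auto simp: nilpotent_group_def)
qed

text \<open>
  The last hypothesis says that \<open>k \<mapsto> (f k, g k)\<close> embeds \<open>K\<close> into \<open>A \<times> B\<close>. Once both
  lower central series have reached the trivial group, each homomorphism kills that term of the
  series of \<open>K\<close>. Speaking of two homomorphisms avoids computing the series of a product.
\<close>

lemma nilpotent_group_if_jointly_injective:
  assumes "group K" "nilpotent_group A" "nilpotent_group B" "f \<in> hom K A" "g \<in> hom K B"
    and inj: "\<And>k. k \<in> carrier K \<Longrightarrow> f k = \<one>\<^bsub>A\<^esub> \<Longrightarrow> g k = \<one>\<^bsub>B\<^esub> \<Longrightarrow> k = \<one>\<^bsub>K\<^esub>"
  shows "nilpotent_group K"
proof -
  interpret f: group_hom K A f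
    using assms by (simp add: group_hom_def group_hom_axioms_def nilpotent_group_def)
  interpret g: group_hom K B g
    using assms by (simp add: group_hom_def group_hom_axioms_def nilpotent_group_def)
  obtain m n where mn: "lower_central_series A m = {\<one>\<^bsub>A\<^esub>}" "lower_central_series B n = {\<one>\<^bsub>B\<^esub>}"
    using assms(2,3) by (auto simp: nilpotent_group_def)
  define N where "N = max m n"
  have "lower_central_series A N = {\<one>\<^bsub>A\<^esub>}" "lower_central_series B N = {\<one>\<^bsub>B\<^esub>}"
    using f.H.lower_central_series_trivial_mono[OF mn(1)]
      g.H.lower_central_series_trivial_mono[OF mn(2)] by (simp_all add: N_def)
  then have "f k = \<one>\<^bsub>A\<^esub>" "g k = \<one>\<^bsub>B\<^esub>" if "k \<in> lower_central_series K N" for k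
    using that f.lower_central_series_image_subset[of N] g.lower_central_series_image_subset[of N]
    by (simp_all add: image_subset_iff)
  then have "lower_central_series K N \<subseteq> {\<one>\<^bsub>K\<^esub>}"
    using f.G.lower_central_series_in_carrier[of N] inj by blast
  then have "lower_central_series K N = {\<one>\<^bsub>K\<^esub>}"
    using f.G.one_in_lower_central_series by blast
  then show ?thesis
    using assms(1) by (auto simp: nilpotent_group_def)
qed

lemma nilpotent_group_if_comm_group:
  assumes "comm_group G"
  shows "nilpotent_group G"
proof -
  interpret comm_group G by (fact assms)
  have "x \<otimes>\<^bsub>G\<^esub> y \<otimes>\<^bsub>G\<^esub> inv\<^bsub>G\<^esub> x \<otimes>\<^bsub>G\<^esub> inv\<^bsub>G\<^esub> y = \<one>\<^bsub>G\<^esub>"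
    if "x \<in> carrier G" "y \<in> carrier G" for x y
    using that by (metis inv_closed m_closed r_inv inv_mult m_assoc)
  then have "(\<Union>x \<in> carrier G. \<Union>y \<in> carrier G.
      {x \<otimes>\<^bsub>G\<^esub> y \<otimes>\<^bsub>G\<^esub> inv\<^bsub>G\<^esub> x \<otimes>\<^bsub>G\<^esub> inv\<^bsub>G\<^esub> y}) = {\<one>\<^bsub>G\<^esub>}"
    using one_closed by auto
  then have "lower_central_series G 1 = {\<one>\<^bsub>G\<^esub>}"
    by (simp add: generate_one)
  then show ?thesis
    using is_group unfolding nilpotent_group_def by blast
qed

section \<open>Nilpotent two-generated subgroups of a direct product\<close>

text \<open>
  From left to right, the first projection is an epimorphism between the two generated subgroups.
  From right to left, the two projections together are injective, and both of their targets are
  nilpotent.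
\<close>

lemma nilpotent_subgroup_generated_DirProd_iff:
  assumes "group G" "nilpotent_group H"
    and "a \<in> carrier G" "b \<in> carrier G" "x \<in> carrier H" "y \<in> carrier H"
  shows "nilpotent_group (subgroup_generated (G \<times>\<times> H) {(a, x), (b, y)}) \<longleftrightarrow>
         nilpotent_group (subgroup_generated G {a, b})"
    (is "nilpotent_group ?K \<longleftrightarrow> nilpotent_group ?L")
proof -
  have H: "group H"
    using assms(2) by (simp add: nilpotent_group_def)
  interpret G: group G by (fact assms(1))
  interpret P: group "G \<times>\<times> H"
    using assms(1) H by (rule DirProd_group)
  interpret fst: group_hom "G \<times>\<times> H" G fst
    using assms(1) by unfold_locales (auto simp: hom_def mult_DirProd')
  have fst_K: "fst \<in> epi ?K ?L"
    using fst.hom_between_subgroups[of "{(a, x), (b, y)}" "{a, b}"]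
      fst.subgroup_generated_by_image[of "{(a, x), (b, y)}"] assms
    by (simp add: epi_def)
  have snd_K: "snd \<in> hom ?K H"
    by (rule P.hom_from_subgroup_generated) (auto simp: hom_def mult_DirProd')
  show ?thesis
  proof
    assume "nilpotent_group ?K"
    then show "nilpotent_group ?L"
      by (rule nilpotent_group_epi_image[OF _ _ fst_K]) simp
  next
    assume "nilpotent_group ?L"
    moreover have "fst \<in> hom ?K ?L"
      using fst_K by (simp add: epi_def)
    ultimately show "nilpotent_group ?K"
      by (rule nilpotent_group_if_jointly_injective[OF P.group_subgroup_generated _ assms(2) _ snd_K])
        (simp_all add: prod_eq_iff)
  qed
qed

lemma nil_set_DirProd:
  assumes "group G" "nilpotent_group H"
  shows "nil_set (G \<times>\<times> H) = nil_set G \<times> carrier H"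
proof -
  have H: "\<one>\<^bsub>H\<^esub> \<in> carrier H"
    using assms(2) by (simp add: nilpotent_group_def group.is_monoid monoid.one_closed)
  have "(a, x) \<in> nil_set (G \<times>\<times> H) \<longleftrightarrow> a \<in> nil_set G \<and> x \<in> carrier H" for a x
  proof (cases "a \<in> carrier G \<and> x \<in> carrier H")
    case True
    then have "(a, x) \<in> nil_set (G \<times>\<times> H) \<longleftrightarrow>
        (\<forall>b \<in> carrier G. \<forall>y \<in> carrier H. nilpotent_group (subgroup_generated G {a, b}))"
      using nilpotent_subgroup_generated_DirProd_iff[OF assms] by (simp add: nil_set_def)
    with True H show ?thesis
      by (auto simp: nil_set_def)
  qed (auto simp: nil_set_def)
  then show ?thesis
    by auto
qed

section \<open>Components of symmetric digraphs\<close>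

text \<open>
  Connectedness ignores the direction of arcs, so a subgraph of a symmetric digraph need not be
  symmetric and may be connected without being strongly connected. Maximality removes the
  difference: a subgraph on the same vertices with more arcs stays connected, so a maximal
  connected subgraph is induced, hence symmetric.
\<close>

lemma strongly_connected_imp_connected:
  assumes "strongly_connected \<Gamma>"
  shows "Digraph_Component.connected \<Gamma>"
proof -
  have "(u, v) \<in> rtrancl_on (verts \<Gamma>) ((arcs_ends \<Gamma>)\<^sup>s)"
    if "(u, v) \<in> rtrancl_on (verts \<Gamma>) (arcs_ends \<Gamma>)" for u v
    by (rule rtrancl_on_mono[OF _ _ that]) (simp_all add: symcl_def)
  then show ?thesis
    using assms by (simp add: connected_conv strongly_connected_def reachable_def)
qed

lemma (in sym_digraph) connected_iff_strongly_connected: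
  "Digraph_Component.connected G \<longleftrightarrow> strongly_connected G"
  using symmetric_connected_imp_strongly_connected[OF sym_arcs] strongly_connected_imp_connected
  by blast

lemma (in sym_digraph) connected_induced_imp_strongly_connected:
  assumes "induced_subgraph C G" "Digraph_Component.connected C"
  shows "strongly_connected C"
proof -
  interpret C: wf_digraph C
    using assms(1) by (rule wf_digraphI_induced)
  have "symmetric C"
    using sym_arcs assms(1) by (rule induced_graph_imp_symmetric)
  then show ?thesis
    using assms(2) by (rule C.symmetric_connected_imp_strongly_connected)
qed

lemma arc_mono_connected: "arc_mono Digraph_Component.connected"
  unfolding arc_mono_def
proof (intro allI impI, elim conjE)
  fix C D :: "('a, 'b) pre_digraph"
  assume C: "Digraph_Component.connected C" and "subgraph C D" "verts C = verts D"
  then have "spanning C D" "wf_digraph D"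
    by (auto simp: spanning_def)
  then show "Digraph_Component.connected D"
    using C by (simp add: wf_digraph.connected_spanning_imp_connected)
qed

lemma (in sym_digraph) connected_components_eq_sccs:
  "connected_components G = sccs"
proof -
  have "max_subgraph strongly_connected C" if C: "max_subgraph Digraph_Component.connected C" for C
    using connected_induced_imp_strongly_connected[OF induced_subgraphI_arc_mono[OF C arc_mono_connected]
      max_subgraph_prop[OF C]]
    by (rule max_subgraph_mp[OF C strongly_connected_imp_connected, rotated])
  moreover have "max_subgraph Digraph_Component.connected C"
    if C: "max_subgraph strongly_connected C" for C
  proof (rule max_subgraphI)
    show "Digraph_Component.connected C"
      using C by (simp add: max_subgraph_prop strongly_connected_imp_connected)
    show "subgraph C G"
      using C by (rule subgraphI_max_subgraph)
    fix D assume D: "C \<noteq> D" "subgraph C D" "subgraph D G"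
    show "\<not> Digraph_Component.connected D"
    proof
      assume con: "Digraph_Component.connected D"
      \<comment> \<open>Filling in the missing arcs of \<open>D\<close> makes it symmetric, so that the maximality of \<open>C\<close>
        applies.\<close>
      let ?E = "G \<restriction> verts D"
      have sub: "subgraph D ?E" and ind: "induced_subgraph ?E G"
        using D(3) by (auto intro: subgraph_induce_subgraphI2)
      have "Digraph_Component.connected ?E"
        using arc_mono_connected con sub unfolding arc_mono_def
        by (metis induce_subgraph_verts)
      with ind have "strongly_connected ?E"
        by (rule connected_induced_imp_strongly_connected)
      moreover have "subgraph C ?E"
        using D(2) sub by (rule subgraph_trans)
      ultimately have "?E = C"
        using C ind by (auto simp: max_subgraph_def)
      with sub have DC: "subgraph D C"
        by simp
      have "verts C = verts D" "arcs C = arcs D"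
        using DC D(2) by (auto dest: subgraph_imp_subverts elim!: subgraphE)
      moreover have "tail C = tail D" "head C = head D"
        using DC by (simp_all add: subgraph_def compatible_def)
      ultimately show False
        using D(1) by simp
    qed
  qed
  ultimately show ?thesis
    unfolding connected_components_def sccs_altdef2 by blast
qed

lemma (in sym_digraph) card_connected_components:
  "card (connected_components G) = card sccs_verts"
  by (simp add: connected_components_eq_sccs card_sccs_verts)

text \<open>
  A contraction of graphs, stated so that exactly reachability is controlled: arcs project to
  paths, arcs lift to paths between any prescribed points of the fibres, and each fibre lies in
  one component. Allowing paths of length zero in \<open>adj_imp\<close> is essential, since arcs inside a
  fibre collapse to a point and the graphs here are free of loops.
\<close>

locale reachability_projection = \<Delta>: sym_digraph \<Delta> + \<Gamma>: sym_digraph \<Gamma>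
  for \<Delta> :: "('u, 'e) pre_digraph" and \<Gamma> :: "('v, 'f) pre_digraph" +
  fixes \<pi> :: "'u \<Rightarrow> 'v"
  assumes surj: "\<pi> ` verts \<Delta> = verts \<Gamma>"
    and adj_imp: "u \<rightarrow>\<^bsub>\<Delta>\<^esub> v \<Longrightarrow> \<pi> u \<rightarrow>\<^sup>*\<^bsub>\<Gamma>\<^esub> \<pi> v"
    and adj_lift: "u \<in> verts \<Delta> \<Longrightarrow> v \<in> verts \<Delta> \<Longrightarrow> \<pi> u \<rightarrow>\<^bsub>\<Gamma>\<^esub> \<pi> v \<Longrightarrow> u \<rightarrow>\<^sup>*\<^bsub>\<Delta>\<^esub> v"
    and fibre: "u \<in> verts \<Delta> \<Longrightarrow> v \<in> verts \<Delta> \<Longrightarrow> \<pi> u = \<pi> v \<Longrightarrow> u \<rightarrow>\<^sup>*\<^bsub>\<Delta>\<^esub> v"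
begin

lemma reachable_iff:
  assumes "u \<in> verts \<Delta>" "v \<in> verts \<Delta>"
  shows "u \<rightarrow>\<^sup>*\<^bsub>\<Delta>\<^esub> v \<longleftrightarrow> \<pi> u \<rightarrow>\<^sup>*\<^bsub>\<Gamma>\<^esub> \<pi> v"
proof
  assume "u \<rightarrow>\<^sup>*\<^bsub>\<Delta>\<^esub> v"
  then show "\<pi> u \<rightarrow>\<^sup>*\<^bsub>\<Gamma>\<^esub> \<pi> v"
  proof (induction rule: \<Delta>.converse_reachable_induct)
    case base
    then show ?case
      using surj by auto
  next
    case (step u w)
    then show ?case
      using adj_imp \<Gamma>.reachable_trans by blast
  qed
next
  \<comment> \<open>Every point of the fibre is needed in the induction, as a lifted arc may end anywhere in the
    next fibre.\<close>
  have "\<forall>u \<in> verts \<Delta>. \<pi> u = p \<longrightarrow> u \<rightarrow>\<^sup>*\<^bsub>\<Delta>\<^esub> v" if "p \<rightarrow>\<^sup>*\<^bsub>\<Gamma>\<^esub> \<pi> v" for p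
    using that
  proof (induction rule: \<Gamma>.converse_reachable_induct)
    case base
    then show ?case
      using fibre assms(2) by blast
  next
    case (step p q)
    then obtain w where "w \<in> verts \<Delta>" "\<pi> w = q"
      using surj by (metis \<Gamma>.adj_in_verts(2) imageE)
    then show ?case
      using step adj_lift \<Delta>.reachable_trans by blast
  qed
  then show "u \<rightarrow>\<^sup>*\<^bsub>\<Delta>\<^esub> v" if "\<pi> u \<rightarrow>\<^sup>*\<^bsub>\<Gamma>\<^esub> \<pi> v"
    using that assms(1) by blast
qed

lemma strongly_connected_iff: "strongly_connected \<Delta> \<longleftrightarrow> strongly_connected \<Gamma>"
  unfolding strongly_connected_def surj[symmetric] by (auto simp: reachable_iff)

lemma scc_of_iff:
  assumes "u \<in> verts \<Delta>" "v \<in> verts \<Delta>"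
  shows "v \<in> \<Delta>.scc_of u \<longleftrightarrow> \<pi> v \<in> \<Gamma>.scc_of (\<pi> u)"
  using assms by (simp add: \<Delta>.scc_of_def \<Gamma>.scc_of_def reachable_iff)

lemma image_scc_of:
  assumes u: "u \<in> verts \<Delta>"
  shows "\<pi> ` \<Delta>.scc_of u = \<Gamma>.scc_of (\<pi> u)"
proof (intro equalityI subsetI)
  fix q assume "q \<in> \<pi> ` \<Delta>.scc_of u"
  then obtain v where v: "v \<in> \<Delta>.scc_of u" "q = \<pi> v"
    by blast
  then have "v \<in> verts \<Delta>"
    by (auto simp: \<Delta>.scc_of_def dest: \<Delta>.reachable_in_verts)
  with u v show "q \<in> \<Gamma>.scc_of (\<pi> u)"
    by (simp add: scc_of_iff)
next
  fix q assume q: "q \<in> \<Gamma>.scc_of (\<pi> u)"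
  then have "q \<in> verts \<Gamma>"
    by (auto simp: \<Gamma>.scc_of_def dest: \<Gamma>.reachable_in_verts)
  then obtain v where "v \<in> verts \<Delta>" "q = \<pi> v"
    using surj by (metis imageE)
  with u q show "q \<in> \<pi> ` \<Delta>.scc_of u"
    by (simp add: scc_of_iff)
qed

text \<open>
  Taking images under \<open>\<pi>\<close> is a bijection from the components of \<open>\<Delta>\<close> to those of \<open>\<Gamma>\<close>: it sends the
  component of \<open>u\<close> to that of \<open>\<pi> u\<close>, and it is injective because reachability is reflected.
\<close>

lemma card_sccs_verts_eq: "card \<Delta>.sccs_verts = card \<Gamma>.sccs_verts"
proof (rule bij_betw_same_card[of "image \<pi>"], rule bij_betw_imageI)
  show "inj_on (image \<pi>) \<Delta>.sccs_verts"
  proof (rule inj_onI)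
    fix S T assume "S \<in> \<Delta>.sccs_verts" "T \<in> \<Delta>.sccs_verts" and eq: "\<pi> ` S = \<pi> ` T"
    then obtain u v where u: "u \<in> verts \<Delta>" "S = \<Delta>.scc_of u"
      and v: "v \<in> verts \<Delta>" "T = \<Delta>.scc_of v"
      unfolding \<Delta>.sccs_verts_conv_scc_of by blast
    have "\<pi> u \<in> verts \<Gamma>"
      using u(1) surj by blast
    then have "\<pi> u \<in> \<Gamma>.scc_of (\<pi> v)"
      using eq u v by (metis image_scc_of \<Gamma>.in_scc_of_self)
    then show "S = T"
      using u v by (simp add: scc_of_iff \<Delta>.scc_of_eq)
  qed
  show "image \<pi> ` \<Delta>.sccs_verts = \<Gamma>.sccs_verts"
    unfolding \<Delta>.sccs_verts_conv_scc_of \<Gamma>.sccs_verts_conv_scc_of surj[symmetric] image_image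
    by (rule image_cong) (simp_all add: image_scc_of)
qed

end

section \<open>The projection of the nilpotent graph\<close>

lemma verts_nilpotent_graph [simp]: "verts (nilpotent_graph G) = carrier G - nil_set G"
  by (simp add: nilpotent_graph_def)

lemma nilpotent_graph_adj_iff:
  "g \<rightarrow>\<^bsub>nilpotent_graph G\<^esub> h \<longleftrightarrow>
     g \<in> carrier G - nil_set G \<and> h \<in> carrier G - nil_set G \<and> g \<noteq> h \<and>
     nilpotent_group (subgroup_generated G {g, h})"
  by (force simp: nilpotent_graph_def arcs_ends_def arc_to_ends_def)

lemma nilpotent_graph_DirProd_projection:
  fixes G :: "('a, 'b) monoid_scheme" and H :: "('c, 'd) monoid_scheme"
  assumes G: "group G" "finite (carrier G)" and H: "nilpotent_group H" "finite (carrier H)"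
  shows "reachability_projection (nilpotent_graph (G \<times>\<times> H)) (nilpotent_graph G) fst"
proof -
  interpret \<Delta>: graph "nilpotent_graph (G \<times>\<times> H)"
    using G(2) H(2) by (intro graph_nilpotent_graph) simp
  interpret \<Gamma>: graph "nilpotent_graph G"
    using G(2) by (rule graph_nilpotent_graph)
  interpret G: group G by (fact G(1))
  note nil = nil_set_DirProd[OF G(1) H(1)]
  note two_gen = nilpotent_subgroup_generated_DirProd_iff[OF G(1) H(1)]
  \<comment> \<open>The case of two vertices in one fibre, where the projected pair is a single element.\<close>
  have cyclic: "nilpotent_group (subgroup_generated G {a})" for a
    by (intro nilpotent_group_if_comm_group group.cyclic_imp_abelian_group
        G.cyclic_group_generated G.group_subgroup_generated)
  show ?thesis
  proof
    have "\<one>\<^bsub>H\<^esub> \<in> carrier H"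
      using H(1) by (auto simp: nilpotent_group_def dest: group.is_monoid)
    then show "fst ` verts (nilpotent_graph (G \<times>\<times> H)) = verts (nilpotent_graph G)"
      by (force simp: nil)
  next
    fix u v assume uv: "u \<rightarrow>\<^bsub>nilpotent_graph (G \<times>\<times> H)\<^esub> v"
    then have "fst u = fst v \<or> fst u \<rightarrow>\<^bsub>nilpotent_graph G\<^esub> fst v"
      by (cases u; cases v) (auto simp: nilpotent_graph_adj_iff nil two_gen)
    moreover have "fst u \<in> verts (nilpotent_graph G)"
      using uv by (cases u) (auto simp: nilpotent_graph_adj_iff nil)
    ultimately show "fst u \<rightarrow>\<^sup>*\<^bsub>nilpotent_graph G\<^esub> fst v"
      by (metis \<Gamma>.reachable_adjI \<Gamma>.reachable_refl)
  next
    fix u v assume "u \<in> verts (nilpotent_graph (G \<times>\<times> H))" "v \<in> verts (nilpotent_graph (G \<times>\<times> H))"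
      and "fst u \<rightarrow>\<^bsub>nilpotent_graph G\<^esub> fst v"
    then have "u \<rightarrow>\<^bsub>nilpotent_graph (G \<times>\<times> H)\<^esub> v"
      by (cases u; cases v) (auto simp: nilpotent_graph_adj_iff nil two_gen)
    then show "u \<rightarrow>\<^sup>*\<^bsub>nilpotent_graph (G \<times>\<times> H)\<^esub> v"
      by (rule \<Delta>.reachable_adjI)
  next
    fix u v assume uv: "u \<in> verts (nilpotent_graph (G \<times>\<times> H))" "v \<in> verts (nilpotent_graph (G \<times>\<times> H))"
      and "fst u = fst v"
    then have "u = v \<or> u \<rightarrow>\<^bsub>nilpotent_graph (G \<times>\<times> H)\<^esub> v"
      by (cases u; cases v) (auto simp: nilpotent_graph_adj_iff nil two_gen cyclic)
    with uv show "u \<rightarrow>\<^sup>*\<^bsub>nilpotent_graph (G \<times>\<times> H)\<^esub> v"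
      by (metis \<Delta>.reachable_adjI \<Delta>.reachable_refl)
  qed
qed

lemma
  fixes G :: "('a, 'b) monoid_scheme" and H :: "('c, 'd) monoid_scheme"
  assumes G: "group G" "finite (carrier G)" and H: "nilpotent_group H" "finite (carrier H)"
  shows kappa_DirProd_nilpotent: "kappa (G \<times>\<times> H) = kappa G"
    and connected_nilpotent_graph_DirProd_iff:
      "Digraph_Component.connected (nilpotent_graph (G \<times>\<times> H)) \<longleftrightarrow>
         Digraph_Component.connected (nilpotent_graph G)"
proof -
  interpret reachability_projection "nilpotent_graph (G \<times>\<times> H)" "nilpotent_graph G" fst
    using assms by (rule nilpotent_graph_DirProd_projection)
  show "kappa (G \<times>\<times> H) = kappa G"
    unfolding kappa_def \<Delta>.card_connected_components \<Gamma>.card_connected_components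
    by (rule card_sccs_verts_eq)
  show "Digraph_Component.connected (nilpotent_graph (G \<times>\<times> H)) \<longleftrightarrow>
         Digraph_Component.connected (nilpotent_graph G)"
    unfolding \<Delta>.connected_iff_strongly_connected \<Gamma>.connected_iff_strongly_connected
    by (rule strongly_connected_iff)
qed

lemma ex_finite_nilpotent_group:
  "\<exists>H :: ('c, 'd) monoid_scheme. nilpotent_group H \<and> finite (carrier H)"
proof (intro exI conjI)
  let ?H = "\<lparr>carrier = {undefined}, monoid.mult = \<lambda>x y. undefined, one = undefined, \<dots> = undefined\<rparr>
    :: ('c, 'd) monoid_scheme"
  have "comm_group ?H"
    by (rule comm_groupI) auto
  then show "nilpotent_group ?H"
    by (rule nilpotent_group_if_comm_group)
  show "finite (carrier ?H)"
    by simp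
qed

theorem theorem4p5:
  fixes G :: "('a, 'b) monoid_scheme"
  assumes "group G" and "finite (carrier G)" and "\<not> nilpotent_group G"
  shows "(\<forall>H :: ('c, 'd) monoid_scheme. nilpotent_group H \<and> finite (carrier H) \<longrightarrow>
            kappa (G \<times>\<times> H) = kappa G) \<and>
         (Digraph_Component.connected (nilpotent_graph G) \<longleftrightarrow>
           (\<forall>H :: ('c, 'd) monoid_scheme. nilpotent_group H \<and> finite (carrier H) \<longrightarrow>
              Digraph_Component.connected (nilpotent_graph (G \<times>\<times> H))))"
proof (intro conjI allI impI iffI; (elim conjE)?)
  fix H :: "('c, 'd) monoid_scheme"
  assume H: "nilpotent_group H" "finite (carrier H)"
  show "kappa (G \<times>\<times> H) = kappa G"
    using assms(1,2) H by (rule kappa_DirProd_nilpotent)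
  assume "Digraph_Component.connected (nilpotent_graph G)"
  then show "Digraph_Component.connected (nilpotent_graph (G \<times>\<times> H))"
    using connected_nilpotent_graph_DirProd_iff[OF assms(1,2) H] by simp
next
  assume all: "\<forall>H :: ('c, 'd) monoid_scheme. nilpotent_group H \<and> finite (carrier H) \<longrightarrow>
    Digraph_Component.connected (nilpotent_graph (G \<times>\<times> H))"
  obtain H :: "('c, 'd) monoid_scheme" where H: "nilpotent_group H" "finite (carrier H)"
    using ex_finite_nilpotent_group by blast
  then have "Digraph_Component.connected (nilpotent_graph (G \<times>\<times> H))"
    using all by simp
  then show "Digraph_Component.connected (nilpotent_graph G)"
    using connected_nilpotent_graph_DirProd_iff[OF assms(1,2) H] by simp
qed

end
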